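(* Let $\mathbb{F}_q$ be a finite field of order $q$ and characteristic $p$, let $n, r \in \mathbb{Z}^+$, let $X \subset \mathbb{F}_q^n$ be a nonempty subset, and let $f_1,\ldots,f_r \in \mathbb{F}_q[t_1,\ldots,t_n]$ be polynomials of positive degree. If \[ (q-1) \sum_{j=1}^r \deg(f_j) < \underline{\omega}(X), \] then \[ p \mid \# \{ x \in X \mid f_1(x) = \ldots = f_r(x) = 0 \}. \]
   Context: Here $\mathbb{N}$ is the set of non-negative integers. Let $F$ be a field of characteristic $p>0$ and let $X \subseteq F^n$ be finite and nonempty. For $\underline{k} = (k_1,\ldots,k_n) \in \mathbb{N}^n$ put $|\underline{k}| := k_1+\ldots+k_n$ and \[ \pi_{\underline{k}}(X) := \sum_{(x_1,\ldots,x_n) \in X} x_1^{k_1}\cdots x_n^{k_n} \in F \] (with the convention $x^0 = 1$ for all $x\in F$). Define \[ \underline{\omega}(X) := \inf\{ |\underline{k}| \mid \underline{k} \in \mathbb{N}^n,\ \pi_{\underline{k}}(X) \neq 0\}. \] *)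

theory Defs
  imports "HOL-Analysis.Analysis" "HOL-Library.Poly_Mapping" "HOL-Library.Extended_Nat"
    "HOL-Computational_Algebra.Computational_Algebra"
begin

text \<open>
  Affine space \<open>F\<^sup>n\<close> is \<open>'a ^ 'n\<close>, and \<open>F[t\<^sub>1, \<dots>, t\<^sub>n]\<close> is the ring
  \<open>('n \<Rightarrow>\<^sub>0 nat) \<Rightarrow>\<^sub>0 'a\<close>: a polynomial maps each exponent vector to its coefficient.
\<close>

type_synonym ('a, 'n) mpoly = "('n \<Rightarrow>\<^sub>0 nat) \<Rightarrow>\<^sub>0 'a"

definition expt_size :: "('n::finite \<Rightarrow>\<^sub>0 nat) \<Rightarrow> nat" where
  "expt_size k = (\<Sum>i\<in>UNIV. Poly_Mapping.lookup k i)"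

definition monom_val :: "('n::finite \<Rightarrow>\<^sub>0 nat) \<Rightarrow> 'a::comm_semiring_1 ^ 'n \<Rightarrow> 'a" where
  "monom_val k x = (\<Prod>i\<in>UNIV. x $ i ^ Poly_Mapping.lookup k i)"

definition mpoly_eval :: "('a::comm_semiring_1, 'n::finite) mpoly \<Rightarrow> 'a ^ 'n \<Rightarrow> 'a" where
  "mpoly_eval f x = (\<Sum>k\<in>Poly_Mapping.keys f. Poly_Mapping.lookup f k * monom_val k x)"

text \<open>Total degree; the zero polynomial gets degree \<open>0\<close>.\<close>

definition mpoly_degree :: "('a::zero, 'n::finite) mpoly \<Rightarrow> nat" where
  "mpoly_degree f = Max (insert 0 (expt_size ` Poly_Mapping.keys f))"

text \<open>
  The power sums \<open>\<pi>\<^sub>k(X)\<close>, for finite \<open>X\<close> (for infinite \<open>X\<close> the sum is \<open>0\<close>).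
\<close>

definition power_sum :: "('n::finite \<Rightarrow>\<^sub>0 nat) \<Rightarrow> ('a::field ^ 'n) set \<Rightarrow> 'a" where
  "power_sum k X = (\<Sum>x\<in>X. monom_val k x)"

text \<open>
  The infimum is taken in \<^typ>\<open>enat\<close>, where the infimum of the empty set is \<open>\<infinity>\<close>;
  on \<^typ>\<open>nat\<close> it would be an unspecified number.
\<close>

definition omega_low :: "('a::field ^ 'n::finite) set \<Rightarrow> enat" where
  "omega_low X = Inf {enat (expt_size k) | k. power_sum k X \<noteq> 0}"

end

theory Submission
  imports Defs
begin

text \<open>
  Chevalley's argument: the indicator function of the common zero locus is
  \<open>\<Prod>\<^sub>j (1 - f\<^sub>j\<^bsup>q-1\<^esup>)\<close>, a polynomial function of degree less than \<open>\<omega>(X)\<close>. Its sum over \<open>X\<close>,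
  which is the number of zeros modulo \<open>p\<close>, is thus a combination of vanishing power sums.
\<close>

text \<open>The bound is put on functions, not on elements of the polynomial ring: \<open>d\<close>
  need only bound some expression by monomials, so evaluation never has to be compared with the ring
  multiplication.\<close>

inductive poly_fun_le :: "nat \<Rightarrow> ('a::field ^ 'n::finite \<Rightarrow> 'a) \<Rightarrow> bool" for d where
  zero: "poly_fun_le d (\<lambda>x. 0)"
| add_monom: "poly_fun_le d g \<Longrightarrow> expt_size k \<le> d \<Longrightarrow> poly_fun_le d (\<lambda>x. c * monom_val k x + g x)"

lemma monom_val_0 [simp]: "monom_val 0 x = 1"
  by (simp add: monom_val_def)

lemma expt_size_0 [simp]: "expt_size 0 = 0"
  by (simp add: expt_size_def)

lemma monom_val_add: "monom_val (k + l) x = monom_val k x * monom_val l x"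
  by (simp add: monom_val_def lookup_add power_add prod.distrib)

lemma expt_size_add: "expt_size (k + l) = expt_size k + expt_size l"
  by (simp add: expt_size_def lookup_add sum.distrib)

lemma poly_fun_le_const: "poly_fun_le d (\<lambda>x. c)"
  using poly_fun_le.add_monom[OF poly_fun_le.zero, of 0 d c] by simp

lemma poly_fun_le_add:
  assumes "poly_fun_le d g" "poly_fun_le d h"
  shows "poly_fun_le d (\<lambda>x. g x + h x)"
  using assms(1)
proof induction
  case zero
  then show ?case using assms(2) by simp
next
  case (add_monom g k c)
  then show ?case
    using poly_fun_le.add_monom[of d "\<lambda>x. g x + h x" k c] by (simp add: add.assoc)
qed

text \<open>The case of a single monomial as left factor; the general product follows by induction
  on the left factor.\<close>

lemma poly_fun_le_monom_mult:
  assumes "poly_fun_le e h" "expt_size k \<le> d"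
  shows "poly_fun_le (d + e) (\<lambda>x. c * monom_val k x * h x)"
  using assms(1)
proof induction
  case zero
  then show ?case by (simp add: poly_fun_le.zero)
next
  case (add_monom g l b)
  then have "poly_fun_le (d + e) (\<lambda>x. c * b * monom_val (k + l) x + c * monom_val k x * g x)"
    using assms(2) by (intro poly_fun_le.add_monom) (auto simp: expt_size_add)
  then show ?case by (simp add: monom_val_add algebra_simps)
qed

lemma poly_fun_le_mult:
  assumes "poly_fun_le d g" "poly_fun_le e h"
  shows "poly_fun_le (d + e) (\<lambda>x. g x * h x)"
  using assms(1)
proof induction
  case zero
  then show ?case by (simp add: poly_fun_le.zero)
next
  case (add_monom g k c)
  then show ?case
    using poly_fun_le_add[OF poly_fun_le_monom_mult[OF assms(2), of k d c]]
    by (simp add: distrib_right)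
qed

lemma poly_fun_le_power:
  assumes "poly_fun_le d g"
  shows "poly_fun_le (m * d) (\<lambda>x. g x ^ m)"
  by (induction m) (simp_all add: poly_fun_le_const poly_fun_le_mult[OF assms])

lemma poly_fun_le_prod:
  assumes "\<And>j. j \<in> J \<Longrightarrow> poly_fun_le (d j) (g j)"
  shows "poly_fun_le (\<Sum>j\<in>J. d j) (\<lambda>x. \<Prod>j\<in>J. g j x)"
  using assms
  \<comment> \<open>For infinite \<open>J\<close> the sum defaults to 0 and the product to 1, so
    this case is again a constant function.\<close>
  by (induction J rule: infinite_finite_induct) (simp_all add: poly_fun_le_const poly_fun_le_mult)

lemma poly_fun_le_mpoly_eval: "poly_fun_le (mpoly_degree f) (mpoly_eval f)"
proof -
  \<comment> \<open>Inducting over subsets of the support keeps \<open>f\<close>, and with it the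
    degree bound, fixed.\<close>
  have "poly_fun_le (mpoly_degree f) (\<lambda>x. \<Sum>k\<in>K. Poly_Mapping.lookup f k * monom_val k x)"
    if "finite K" "K \<subseteq> Poly_Mapping.keys f" for K
    using that
  proof (induction K)
    case empty
    then show ?case by (simp add: poly_fun_le.zero)
  next
    case (insert k K)
    then have "expt_size k \<le> mpoly_degree f"
      by (auto simp: mpoly_degree_def intro!: Max_ge)
    with insert show ?case
      by (simp add: poly_fun_le.add_monom)
  qed
  from this[of "Poly_Mapping.keys f"] show ?thesis
    by (simp add: mpoly_eval_def[abs_def])
qed

lemma sum_poly_fun_le_eq_0:
  assumes "poly_fun_le d g" "enat d < omega_low X"
  shows "(\<Sum>x\<in>X. g x) = 0"
  using assms(1)
proof induction
  case zero
  then show ?case by simp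
next
  case (add_monom g k c)
  \<comment> \<open>Otherwise \<open>expt_size k\<close> would be one of the values whose infimum is
    \<open>omega_low X\<close>, although it is at most \<open>d\<close>.\<close>
  have "power_sum k X = 0"
  proof (rule ccontr)
    assume "power_sum k X \<noteq> 0"
    then have "omega_low X \<le> enat (expt_size k)"
      unfolding omega_low_def by (intro Inf_lower) auto
    also have "\<dots> \<le> enat d" using add_monom by simp
    finally show False using assms(2) by simp
  qed
  with add_monom show ?case
    by (simp add: sum.distrib power_sum_def flip: sum_distrib_left)
qed

text \<open>Multiplication by \<open>a\<close> permutes the nonzero elements, so their product is
  unchanged by the factor \<open>a ^ (CARD('a) - 1)\<close>; being nonzero, it cancels.\<close>

lemma finite_field_power_card_minus_1:
  fixes a :: "'a::{field, finite}"
  assumes "a \<noteq> 0"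
  shows "a ^ (CARD('a) - 1) = 1"
proof -
  let ?U = "UNIV - {0::'a}"
  have "bij_betw ((*) a) ?U ?U"
    by (rule bij_betw_byWitness[where f' = "\<lambda>x. x / a"]) (use assms in auto)
  then have "(\<Prod>x\<in>?U. a * x) = \<Prod>?U"
    by (rule prod.reindex_bij_betw)
  then have "a ^ card ?U * \<Prod>?U = \<Prod>?U"
    by (simp add: prod.distrib)
  moreover have "\<Prod>?U \<noteq> 0" by simp
  ultimately show ?thesis
    by (simp add: card_Diff_singleton)
qed

theorem theorem1p7:
  fixes X :: "('a::{field, finite} ^ 'n::finite) set"
    and f :: "nat \<Rightarrow> ('a, 'n) mpoly"
    and p q r :: nat
  assumes "CARD('a) = q" and "CHAR('a) = p"
    and "r \<ge> 1"
    and "X \<noteq> {}"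
    and "\<And>j. j \<in> {1..r} \<Longrightarrow> mpoly_degree (f j) > 0"
    and "enat ((q - 1) * (\<Sum>j = 1..r. mpoly_degree (f j))) < omega_low X"
  shows "p dvd card {x \<in> X. \<forall>j \<in> {1..r}. mpoly_eval (f j) x = 0}"
proof -
  define g where "g x = (\<Prod>j = 1..r. 1 + (-1) * mpoly_eval (f j) x ^ (q - 1))" for x
  \<comment> \<open>A field has at least two elements; a positive exponent \<open>q - 1\<close> is
    what makes \<open>0 ^ (q - 1)\<close> equal 0 rather than 1.\<close>
  have "card {0, 1 :: 'a} \<le> CARD('a)" by (rule card_mono) auto
  then have q: "q - 1 > 0" using assms(1) by simp
  have pw: "a ^ (q - 1) = (if a = 0 then 0 else 1)" for a :: 'a
    using finite_field_power_card_minus_1[of a] q assms(1) by simp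
  have "poly_fun_le ((q - 1) * mpoly_degree (f j)) (\<lambda>x. 1 + (-1) * mpoly_eval (f j) x ^ (q - 1))"
    for j
    using poly_fun_le_mult[OF poly_fun_le_const[of 0 "-1"]
        poly_fun_le_power[OF poly_fun_le_mpoly_eval, of "q - 1" "f j"]]
    by (intro poly_fun_le_add poly_fun_le_const) simp
  then have "poly_fun_le (\<Sum>j = 1..r. (q - 1) * mpoly_degree (f j)) g"
    unfolding g_def[abs_def] by (rule poly_fun_le_prod)
  then have "(\<Sum>x\<in>X. g x) = 0"
    using assms(6) by (intro sum_poly_fun_le_eq_0) (auto simp: sum_distrib_left)
  \<comment> \<open>By \<open>pw\<close> each factor is 1 at a zero of \<open>f j\<close> and 0
    elsewhere, so a single nonvanishing \<open>f j\<close> kills the product.\<close>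
  moreover have "g x = (if \<forall>j\<in>{1..r}. mpoly_eval (f j) x = 0 then 1 else 0)" for x
    unfolding g_def pw by (auto intro!: prod.neutral prod_zero)
  \<comment> \<open>Summing the indicator counts the zeros inside the field, where a natural number
    vanishes exactly when the characteristic divides it.\<close>
  ultimately have "of_nat (card {x \<in> X. \<forall>j \<in> {1..r}. mpoly_eval (f j) x = 0}) = (0 :: 'a)"
    by (simp add: sum.If_cases Int_def)
  then show ?thesis
    using assms(2) by (simp add: of_nat_eq_0_iff_char_dvd)
qed

end
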